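(* Let $T>0$, $a>0$, $\omega=\frac{2\pi}{T}$, and let $\lambda$ and $k$ be constants. Let $\varphi:(-a,a)\to\mathbb{R}$ be increasing, of class $C^2$, with $\varphi(0)=0$ and $\lim_{z\to\pm a}\varphi(z)=\pm\infty$. Let $g\in C^1(\mathbb{R})$, and let $e\in C(\mathbb{R})$ be $T$-periodic with $\int_0^T e(t)\,dt=0$. Assume that there is a constant $a_0$ such that $\varphi'(z)\ge a_0$ for all $z\in(-a,a)$, that $|g'(u)|\le 1$ for all $u\in\mathbb{R}$, and that $k<a_0\omega$. Assume in addition that $g$ has finite limits $g(\pm\infty)=\lim_{u\to\pm\infty}g(u)$ and that $$g(-\infty)<g(u)<g(\infty)\quad\text{for all }u\in\mathbb{R}.$$ Let $\mu\in\mathbb{R}$. Then the equation $$(\varphi(u'))'+\lambda u'+k g(u)=\mu+e(t)$$ has a $T$-periodic solution if and only if $$k g(-\infty)<\mu<k g(\infty).$$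
   Context: Solutions are classical: a $T$-periodic solution is a $T$-periodic $u\in C^2(\mathbb{R})$ with $|u'(t)|<a$ for all $t$ that satisfies the equation for all $t$.
   Formalization: The formal statement adds k > 0; for k ≤ 0 the claim fails: with e = 0 and μ = k g(0), the constant u = 0 is a T-periodic solution, but k g(-∞) < μ < k g(∞) cannot hold. *)

theory Defs
  imports "HOL-Analysis.Analysis" "HOL-Library.Periodic_Fun"
begin

text \<open>Intended for open \<open>S\<close>, where the derivatives in \<^const>\<open>deriv\<close> and in
  \<^const>\<open>C1_differentiable_on\<close> are the ordinary two-sided ones.\<close>

definition C2_differentiable_on :: "(real \<Rightarrow> real) \<Rightarrow> real set \<Rightarrow> bool"
    (infix \<open>C2'_differentiable'_on\<close> 50)
  where "f C2_differentiable_on S \<longleftrightarrow>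
    (\<forall>x\<in>S. f differentiable (at x)) \<and> deriv f C1_differentiable_on S"

text \<open>Classical \<open>T\<close>-periodic solutions of \<open>(\<phi>(u'))' + lam u' + k g(u) = \<mu> + e(t)\<close>.
  If \<open>\<phi>\<close> is differentiable on \<open>(-a, a)\<close>, the first conditions on \<open>u\<close> make
  \<open>\<lambda>s. \<phi> (deriv u s)\<close> differentiable, so the outer \<^const>\<open>deriv\<close> is a genuine derivative.
  Only the values of \<open>\<phi>\<close> on \<open>(-a, a)\<close> matter.\<close>

definition periodic_solution ::
  "real \<Rightarrow> real \<Rightarrow> (real \<Rightarrow> real) \<Rightarrow> real \<Rightarrow> real \<Rightarrow> (real \<Rightarrow> real) \<Rightarrow> real \<Rightarrow> (real \<Rightarrow> real)
    \<Rightarrow> (real \<Rightarrow> real) \<Rightarrow> bool"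
  where "periodic_solution T a \<phi> lam k g \<mu> e u \<longleftrightarrow>
    periodic_fun_simple u T \<and>
    u C2_differentiable_on UNIV \<and>
    (\<forall>t. \<bar>deriv u t\<bar> < a) \<and>
    (\<forall>t. deriv (\<lambda>s. \<phi> (deriv u s)) t + lam * deriv u t + k * g (u t) = \<mu> + e t)"

end

theory Submission imports Defs begin

text \<open>Necessity: \<open>\<phi> (u') + lam u - E\<close>, with \<open>E\<close> an antiderivative of \<open>e\<close>, takes equal values at
  \<open>0\<close> and \<open>T\<close>, so its derivative \<open>\<mu> - k g (u)\<close> vanishes somewhere.

  Sufficiency: with \<open>h\<close> the inverse of \<open>\<phi>\<close> and \<open>y = \<phi> (u')\<close> the equation is the planar system
  \<open>u' = h (y)\<close>, \<open>y' = \<mu> + e - lam h (y) - k g (u)\<close>, whose right-hand side is bounded and Lipschitz.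
  Over one period \<open>u\<close> and \<open>y\<close> move by a bounded amount, so on a large rectangle of initial values
  the increment of \<open>u\<close> has the sign of \<open>y\<close> on the sides \<open>y = const\<close>, and the increment of
  \<open>y + lam u - E\<close> has the sign opposite to \<open>u\<close> on the sides \<open>u = const\<close>. By Poincare--Miranda
  both increments vanish at some initial value, and uniqueness makes that solution periodic.\<close>

section \<open>Antiderivatives, growth bounds and global solutions of differential equations on the
  line\<close>

lemma antiderivative_on_line:
  fixes F :: "real \<Rightarrow> 'a::banach"
  assumes "continuous_on UNIV F"
  obtains A where "A 0 = 0" "\<And>t. (A has_vector_derivative F t) (at t)"
proof -
  \<comment> \<open>One of the two intervals is empty or a point, so the difference is the oriented
    integral from \<open>0\<close> to \<open>t\<close> for either sign of \<open>t\<close>.\<close>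
  define A where "A t = integral {0..t} F - integral {t..0} F" for t
  have int: "F integrable_on {x..y}" for x y
    using assms continuous_on_subset integrable_continuous_real by blast
  have "(A has_vector_derivative F t) (at t)" for t
  proof -
    define r where "r = \<bar>t\<bar> + 1"
    \<comment> \<open>Near \<open>t\<close>, \<open>A\<close> differs by a constant from the
      integral with base point \<open>-r\<close>. This point lies to the left of both
      \<open>0\<close> and \<open>t\<close>, so the usual rule for differentiating an integral
      applies.\<close>
    have eq: "A s = integral {-r..s} F - integral {-r..0} F" if "s \<in> {-r<..<r}" for s
    proof (cases "0 \<le> s")
      case True
      then show ?thesis
        using Henstock_Kurzweil_Integration.integral_combine[of "-r" 0 s F] int r_def
        by (cases "s = 0") (auto simp: A_def algebra_simps)
    next
      case False
      then show ?thesis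
        using Henstock_Kurzweil_Integration.integral_combine[of "-r" s 0 F] int that
        by (auto simp: A_def algebra_simps)
    qed
    have "((\<lambda>s. integral {-r..s} F) has_vector_derivative F t) (at t within {-r..r})"
      using assms by (intro integral_has_vector_derivative)
        (auto simp: r_def intro: continuous_on_subset)
    then have "((\<lambda>s. integral {-r..s} F) has_vector_derivative F t) (at t)"
      by (simp add: at_within_Icc_at r_def)
    then have "((\<lambda>s. integral {-r..s} F - integral {-r..0} F) has_vector_derivative F t) (at t)"
      by (auto intro!: derivative_eq_intros)
    then show ?thesis
      by (rule has_vector_derivative_transform_within_open[where S="{-r<..<r}"])
        (auto simp: eq r_def)
  qed
  moreover have "A 0 = 0" by (simp add: A_def)
  ultimately show thesis using that by blast
qed

text \<open>The right-hand side is the integral of \<open>M * exp (K * s)\<close> over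
  \<open>{0..t}\<close>. Integration gains the factor \<open>1 / K\<close>, which makes the
  exponentially weighted norm shrink once \<open>K\<close> exceeds the Lipschitz constant.\<close>

lemma exp_growth_bound_nonneg:
  fixes A :: "real \<Rightarrow> 'a::real_normed_vector"
  assumes der: "\<And>t. (A has_vector_derivative A' t) (at t)"
    and bd: "\<And>t. norm (A' t) \<le> M * exp (K * \<bar>t\<bar>)"
    and K: "K > 0" and t: "t \<ge> 0"
  shows "norm (A t - A 0) \<le> M / K * (exp (K * t) - 1)"
proof (cases "t = 0")
  case False
  have "norm (A t - A 0) \<le> M / K * exp (K * t) - M / K * exp (K * 0)"
  proof (rule differentiable_bound_general[where f' = A' and \<phi>' = "\<lambda>s. M * exp (K * s)"])
    show "continuous_on {0..t} A"
      using der has_vector_derivative_continuous continuous_at_imp_continuous_on by blast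
    show "((\<lambda>s. M / K * exp (K * s)) has_vector_derivative M * exp (K * x)) (at x)" for x
      unfolding has_real_derivative_iff_has_vector_derivative[symmetric]
      using K by (auto intro!: derivative_eq_intros)
    show "norm (A' x) \<le> M * exp (K * x)" if "0 < x" for x
      using bd[of x] that by simp
  qed (use False K t der in \<open>auto intro!: continuous_intros\<close>)
  then show ?thesis by (simp add: algebra_simps)
qed simp

lemma exp_growth_bound:
  fixes A :: "real \<Rightarrow> 'a::real_normed_vector"
  assumes der: "\<And>t. (A has_vector_derivative A' t) (at t)"
    and bd: "\<And>t. norm (A' t) \<le> M * exp (K * \<bar>t\<bar>)"
    and K: "K > 0"
  shows "norm (A t - A 0) \<le> M / K * (exp (K * \<bar>t\<bar>) - 1)"
proof (cases "t \<ge> 0")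
  case True
  then show ?thesis using exp_growth_bound_nonneg[OF der bd K] by simp
next
  case False
  \<comment> \<open>Negative times reduce to positive ones by reversing time.\<close>
  have "((\<lambda>s. A (- s)) has_vector_derivative - A' (- s)) (at s)" for s
  proof -
    have "((\<lambda>s. - s) has_vector_derivative - 1) (at s)"
      by (intro has_vector_derivative_minus has_vector_derivative_id)
    from vector_diff_chain_at[OF this der] show ?thesis by (simp add: o_def)
  qed
  from exp_growth_bound_nonneg[OF this _ K, of M "- t"] show ?thesis
    using bd False by (simp add: abs_minus_cancel) (metis abs_minus_cancel)
qed

text \<open>Integration along an \<open>L\<close>-Lipschitz field halves the weighted norm
  \<open>sup\<^sub>t exp (- 2 L \<bar>t\<bar>) \<bar>x t\<bar>\<close>, which is finite for solutions because the field is bounded.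
  This yields the distance estimate, and Picard iteration is a contraction on the whole line.\<close>

lemma bounded_ode_solutions_dist:
  fixes f :: "real \<Rightarrow> 'a::real_normed_vector \<Rightarrow> 'a"
  assumes bd: "\<And>t x. norm (f t x) \<le> C" and L: "L > 0"
    and lip: "\<And>t x y. norm (f t x - f t y) \<le> L * norm (x - y)"
    and x: "\<And>t. (x has_vector_derivative f t (x t)) (at t)"
    and y: "\<And>t. (y has_vector_derivative f t (y t)) (at t)"
  shows "norm (x t - y t) \<le> 2 * norm (x 0 - y 0) * exp (2 * L * \<bar>t\<bar>)"
proof -
  define K where "K = 2 * L"
  define d where "d t = exp (- K * \<bar>t\<bar>) * norm (x t - y t)" for t
  define S where "S = (SUP t. d t)"
  have K: "K > 0" using L by (simp add: K_def)
  have C: "C \<ge> 0" using bd[of 0 0] norm_ge_zero order_trans by blast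
  have der: "((\<lambda>t. x t - y t) has_vector_derivative f t (x t) - f t (y t)) (at t)" for t
    by (intro has_vector_derivative_diff x y)
  \<comment> \<open>Used twice: with \<open>M = 2 * C\<close>, only to know that the supremum
    \<open>S\<close> of \<open>d\<close> is finite, and then with \<open>M = L * S\<close>. As
    \<open>K = 2 * L\<close>, the second use bounds \<open>S\<close> by the initial distance plus
    \<open>S / 2\<close>, and finiteness allows this half to be absorbed.\<close>
  have step: "d t \<le> norm (x 0 - y 0) + M / K"
    if "\<And>t. norm (f t (x t) - f t (y t)) \<le> M * exp (K * \<bar>t\<bar>)" "M \<ge> 0" for M t
  proof -
    have "norm (x t - y t) \<le> norm (x 0 - y 0) + norm ((x t - y t) - (x 0 - y 0))"
      by (metis norm_triangle_sub)
    also have "\<dots> \<le> norm (x 0 - y 0) + M / K * (exp (K * \<bar>t\<bar>) - 1)"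
      using exp_growth_bound[OF der that(1) K, of t] by simp
    also have "\<dots> \<le> norm (x 0 - y 0) * exp (K * \<bar>t\<bar>) + M / K * exp (K * \<bar>t\<bar>)"
      using K that(2) by (intro add_mono) (auto intro!: mult_left_mono divide_right_mono simp: mult_le_cancel_left1)
    finally have "norm (x t - y t) \<le> (norm (x 0 - y 0) + M / K) * exp (K * \<bar>t\<bar>)"
      by (simp add: algebra_simps)
    then show ?thesis
      by (simp add: d_def exp_minus field_simps)
  qed
  have "norm (f t (x t) - f t (y t)) \<le> (2 * C) * exp (K * \<bar>t\<bar>)" for t
  proof -
    have "norm (f t (x t) - f t (y t)) \<le> 2 * C"
      using norm_triangle_ineq4[of "f t (x t)" "f t (y t)"] bd[of t "x t"] bd[of t "y t"] by linarith
    also have "\<dots> \<le> 2 * C * exp (K * \<bar>t\<bar>)"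
      using C K by (simp add: mult_le_cancel_left1)
    finally show ?thesis .
  qed
  from step[OF this] C have "bdd_above (range d)" by (intro bdd_aboveI2) simp
  then have dS: "d t \<le> S" for t by (simp add: S_def cSUP_upper)
  have "0 \<le> d 0" by (simp add: d_def)
  with dS have S: "S \<ge> 0" using order_trans by blast
  have "norm (f t (x t) - f t (y t)) \<le> (L * S) * exp (K * \<bar>t\<bar>)" for t
  proof -
    have "norm (x t - y t) \<le> S * exp (K * \<bar>t\<bar>)"
      using dS[of t] by (simp add: d_def exp_minus field_simps)
    then show ?thesis
      using lip[of t "x t" "y t"] L
      by (metis (no_types, lifting) less_eq_real_def mult.assoc mult_left_mono order_trans)
  qed
  from step[OF this] S L have "d t \<le> norm (x 0 - y 0) + S / 2" for t
    by (simp add: K_def)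
  then have "S \<le> norm (x 0 - y 0) + S / 2"
    unfolding S_def by (intro cSUP_least) auto
  with dS[of t] have "d t \<le> 2 * norm (x 0 - y 0)" by linarith
  then show ?thesis by (simp add: d_def K_def exp_minus field_simps)
qed

lemma bounded_Lipschitz_ode_solution:
  fixes f :: "real \<Rightarrow> 'a::banach \<Rightarrow> 'a"
  assumes cont: "continuous_on UNIV (\<lambda>(t, x). f t x)"
    and bd: "\<And>t x. norm (f t x) \<le> C" and L: "L > 0"
    and lip: "\<And>t x y. norm (f t x - f t y) \<le> L * norm (x - y)"
  obtains x where "x 0 = x0" "\<And>t. (x has_vector_derivative f t (x t)) (at t)"
proof -
  define K where "K = 2 * L"
  have K: "K > 0" using L by (simp add: K_def)
  have C: "C \<ge> 0" using bd[of 0 0] norm_ge_zero order_trans by blast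
  \<comment> \<open>The unknown \<open>y\<close> is a solution divided by
    \<open>exp (K * \<bar>t\<bar>)\<close>, so that it lies in the complete space of bounded
    continuous functions. \<open>F y\<close> is the field along the curve before this
    division.\<close>
  define F where "F y t = f t (exp (K * \<bar>t\<bar>) *\<^sub>R apply_bcontfun y t)" for y t
  have cF: "continuous_on UNIV (F y)" for y
    using continuous_on_compose2[OF cont, of UNIV "\<lambda>t. (t, exp (K * \<bar>t\<bar>) *\<^sub>R apply_bcontfun y t)"]
    by (simp add: F_def continuous_intros)
  have "\<exists>A. \<forall>y. A y 0 = 0 \<and> (\<forall>t. (A y has_vector_derivative F y t) (at t))"
    by (rule choice) (use antiderivative_on_line[OF cF] in blast)
  then obtain A where A0: "\<And>y. A y 0 = 0"
    and A: "\<And>y t. (A y has_vector_derivative F y t) (at t)" by blast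
  \<comment> \<open>The Picard iterate is \<open>x0 + A y t\<close>; the factor in front returns it
    to the weighted variable.\<close>
  define B where "B y t = exp (- K * \<bar>t\<bar>) *\<^sub>R (x0 + A y t)" for y t
  have "B y \<in> bcontfun" for y
  proof -
    have "continuous_on UNIV (A y)"
      using A has_vector_derivative_continuous continuous_at_imp_continuous_on by blast
    then have 1: "continuous_on UNIV (B y)" unfolding B_def by (intro continuous_intros)
    have "norm (F y t) \<le> C * exp (K * \<bar>t\<bar>)" for t
    proof -
      have "norm (F y t) \<le> C" using bd by (simp add: F_def)
      also have "\<dots> \<le> C * exp (K * \<bar>t\<bar>)" using C K by (simp add: mult_le_cancel_left1)
      finally show ?thesis .
    qed
    from exp_growth_bound[OF A this K]
    have g: "norm (A y t) \<le> C / K * (exp (K * \<bar>t\<bar>) - 1)" for t by (simp add: A0)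
    have "norm (B y t) \<le> norm x0 + C / K" for t
    proof -
      have "norm (x0 + A y t) \<le> norm x0 + C / K * (exp (K * \<bar>t\<bar>) - 1)"
        using norm_triangle_ineq[of x0 "A y t"] g[of t] by linarith
      also have "\<dots> \<le> norm x0 * exp (K * \<bar>t\<bar>) + C / K * exp (K * \<bar>t\<bar>)"
        using C K by (intro add_mono mult_left_mono) (auto simp: mult_le_cancel_left1)
      finally show ?thesis unfolding B_def norm_scaleR by (simp add: exp_minus field_simps)
    qed
    then show ?thesis using 1 by (intro bcontfun_normI)
  qed
  then have B: "apply_bcontfun (Bcontfun (B y)) = B y" for y by (simp add: Bcontfun_inverse)
  have "\<exists>!y. Bcontfun (B y) = y"
  proof (rule banach_fix_type[where c = "1/2"])
    show "\<forall>y z. dist (Bcontfun (B y)) (Bcontfun (B z)) \<le> 1 / 2 * dist y z"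
    proof (intro allI dist_bound)
      fix y z t
      \<comment> \<open>The Lipschitz constant contributes \<open>L\<close> and integration divides
        by \<open>K = 2 * L\<close>, hence the contraction factor \<open>1/2\<close>.\<close>
      have "norm (F y s - F z s) \<le> (L * dist y z) * exp (K * \<bar>s\<bar>)" for s
      proof -
        have "norm (F y s - F z s) \<le> L * norm (exp (K * \<bar>s\<bar>) *\<^sub>R (apply_bcontfun y s - apply_bcontfun z s))"
          using lip by (simp add: F_def scaleR_diff_right)
        also have "\<dots> = L * (exp (K * \<bar>s\<bar>) * dist (apply_bcontfun y s) (apply_bcontfun z s))"
          by (simp add: dist_norm)
        also have "\<dots> \<le> L * (exp (K * \<bar>s\<bar>) * dist y z)"
          using L dist_bounded[of y s z] by (intro mult_left_mono) auto
        finally show ?thesis by (simp add: algebra_simps)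
      qed
      from exp_growth_bound[OF has_vector_derivative_diff[OF A A] this K, of t]
      have "norm (A y t - A z t) \<le> dist y z / 2 * (exp (K * \<bar>t\<bar>) - 1)"
        using L by (simp add: A0 K_def)
      also have "\<dots> \<le> dist y z / 2 * exp (K * \<bar>t\<bar>)" by (intro mult_left_mono) auto
      finally show "dist (apply_bcontfun (Bcontfun (B y)) t) (apply_bcontfun (Bcontfun (B z)) t) \<le> 1 / 2 * dist y z"
        unfolding B by (simp add: B_def dist_norm flip: scaleR_diff_right)
          (simp add: exp_minus field_simps)
    qed
  qed auto
  then obtain y where y: "Bcontfun (B y) = y" by blast
  \<comment> \<open>Removing the weight turns the fixed point equation into the integral equation of
    the initial value problem.\<close>
  have "exp (K * \<bar>t\<bar>) *\<^sub>R apply_bcontfun y t = x0 + A y t" for t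
    using B[of y] y by (simp add: B_def flip: exp_add)
  then have "((\<lambda>t. x0 + A y t) has_vector_derivative f t (x0 + A y t)) (at t)" for t
    using A[of y t] by (auto simp: F_def intro!: derivative_eq_intros)
  then show thesis using that[of "\<lambda>t. x0 + A y t"] A0 by simp
qed

text \<open>Apply Brouwer to \<open>z - (p z, q z)\<close> clamped to the rectangle. Where a
  coordinate of the fixed point is interior, the clamp is inactive and the corresponding function
  vanishes. On a side, the clamp gives one sign of that function and the hypothesis the opposite
  one, so it vanishes again.\<close>

lemma Poincare_Miranda_2:
  fixes p q :: "real \<times> real \<Rightarrow> real"
  assumes "R \<ge> 0" "S \<ge> 0"
    and cont: "continuous_on UNIV p" "continuous_on UNIV q"
    and p: "\<And>y. p (R, y) \<ge> 0" "\<And>y. p (- R, y) \<le> 0"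
    and q: "\<And>x. q (x, S) \<ge> 0" "\<And>x. q (x, - S) \<le> 0"
  obtains z where "p z = 0" "q z = 0"
proof -
  define c where "c r s = max (- r) (min r s)" for r s :: real
  define F where "F z = (c R (fst z - p z), c S (snd z - q z))" for z
  have "continuous_on UNIV F"
    unfolding F_def c_def using cont by (intro continuous_intros)
  then have "continuous_on ({-R..R} \<times> {-S..S}) F" by (rule continuous_on_subset) simp
  moreover have "F \<in> {-R..R} \<times> {-S..S} \<rightarrow> {-R..R} \<times> {-S..S}"
    using assms(1,2) by (auto simp: F_def c_def)
  moreover have "compact ({-R..R} \<times> {-S..S})" "convex ({-R..R} \<times> {-S..S})"
    "{-R..R} \<times> {-S..S} \<noteq> {}"
    using assms(1,2) by (auto simp: compact_Times convex_Times)
  ultimately obtain z where z: "F z = z"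
    using brouwer[of "{-R..R} \<times> {-S..S}" F] by blast
  obtain x y where xy: "z = (x, y)" by force
  have clamp: "d = 0" if "c r (s - d) = s" "s = r \<Longrightarrow> d \<ge> 0" "s = - r \<Longrightarrow> d \<le> 0" "r \<ge> 0"
    for r s d :: real
    using that by (auto simp: c_def max_def min_def split: if_splits)
  have "p z = 0" using z p \<open>R \<ge> 0\<close> by (intro clamp[of R x]) (auto simp: F_def xy)
  moreover have "q z = 0" using z q \<open>S \<ge> 0\<close> by (intro clamp[of S y]) (auto simp: F_def xy)
  ultimately show thesis by (rule that)
qed

section \<open>Bounds for the forcing and the inverse of \<open>\<phi>\<close>\<close>

lemma bounded_of_periodic:
  fixes e :: "real \<Rightarrow> real"
  assumes "continuous_on UNIV e" "periodic_fun_simple e T" "T > 0"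
  obtains M where "M \<ge> 0" "\<And>t. \<bar>e t\<bar> \<le> M"
proof -
  interpret periodic_fun_simple e T by fact
  have "bounded (e ` {0..T})"
    using assms(1) by (intro compact_imp_bounded compact_continuous_image)
      (auto intro: continuous_on_subset)
  then obtain M where M: "M > 0" "\<And>t. t \<in> {0..T} \<Longrightarrow> \<bar>e t\<bar> \<le> M"
    by (auto simp: bounded_pos)
  have "\<bar>e t\<bar> \<le> M" for t
  proof -
    have "t - of_int \<lfloor>t / T\<rfloor> * T \<in> {0..T}"
      using \<open>T > 0\<close> floor_divide_lower[of T t] floor_divide_upper[of T t]
      by (auto simp: algebra_simps)
    then show ?thesis using M(2)[of "t - of_int \<lfloor>t / T\<rfloor> * T"] by (simp add: minus_of_int)
  qed
  with M show thesis using that[of M] by simp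
qed

text \<open>The blow-up at both ends makes \<open>\<phi>\<close> onto, so its inverse is defined on
  the whole line with values in \<open>{-a<..<a}\<close>, and slopes of at least \<open>a0\<close>
  make it Lipschitz. The singular equation thereby becomes a system with bounded Lipschitz
  field.\<close>

lemma singular_homeomorphism_inverse:
  fixes \<phi> :: "real \<Rightarrow> real"
  assumes "a > 0" "a0 > 0"
    and mono: "strict_mono_on {-a<..<a} \<phi>"
    and der: "\<And>z. z \<in> {-a<..<a} \<Longrightarrow> (\<phi> has_real_derivative \<phi>' z) (at z)"
    and ge: "\<And>z. z \<in> {-a<..<a} \<Longrightarrow> \<phi>' z \<ge> a0"
    and right: "filterlim \<phi> at_top (at_left a)"
    and left: "filterlim \<phi> at_bot (at_right (- a))"
  obtains h where "\<And>y. h y \<in> {-a<..<a}" "\<And>y. \<phi> (h y) = y"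
    "\<And>z. z \<in> {-a<..<a} \<Longrightarrow> h (\<phi> z) = z"
    "\<And>x y. \<bar>h x - h y\<bar> \<le> 1 / a0 * \<bar>x - y\<bar>"
    "\<And>y. (h has_real_derivative inverse (\<phi>' (h y))) (at y)"
proof -
  have "\<exists>z\<in>{-a<..<a}. \<phi> z = y" for y
  proof -
    have "\<forall>\<^sub>F z in at_left a. y \<le> \<phi> z \<and> z \<in> {0<..<a}"
      using right eventually_at_left_real[OF \<open>a > 0\<close>]
      by (auto simp: filterlim_at_top intro: eventually_conj)
    then obtain z1 where z1: "y \<le> \<phi> z1" "z1 \<in> {0<..<a}"
      using eventually_happens'[OF trivial_limit_at_left_real] by blast
    have "\<forall>\<^sub>F z in at_right (-a). \<phi> z \<le> y \<and> z \<in> {-a<..<0}"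
      using left eventually_at_right_real[of "-a" 0] \<open>a > 0\<close>
      by (auto simp: filterlim_at_bot intro: eventually_conj)
    then obtain z0 where z0: "\<phi> z0 \<le> y" "z0 \<in> {-a<..<0}"
      using eventually_happens'[OF trivial_limit_at_right_real] by blast
    have "\<exists>z\<ge>z0. z \<le> z1 \<and> \<phi> z = y"
      using z0 z1 by (intro IVT) (auto intro!: DERIV_isCont[OF der])
    then show ?thesis using z0 z1 by force
  qed
  then obtain h where h: "\<And>y. h y \<in> {-a<..<a}" "\<And>y. \<phi> (h y) = y" by metis
  have hphi: "h (\<phi> z) = z" if "z \<in> {-a<..<a}" for z
    using strict_mono_on_imp_inj_on[OF mono] h that by (meson inj_on_eq_iff)
  have expand: "a0 * (w - z) \<le> \<phi> w - \<phi> z" if "z < w" "z \<in> {-a<..<a}" "w \<in> {-a<..<a}" for z w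
  proof -
    have "(\<phi> has_real_derivative \<phi>' x) (at x)" if "z \<le> x" "x \<le> w" for x
      using that \<open>z \<in> _\<close> \<open>w \<in> _\<close> by (intro der) auto
    from MVT2[OF \<open>z < w\<close> this]
    obtain x where x: "z < x" "x < w" "\<phi> w - \<phi> z = (w - z) * \<phi>' x" by blast
    moreover have "a0 \<le> \<phi>' x" using x that by (intro ge) auto
    ultimately show ?thesis using that by (simp add: mult.commute)
  qed
  have "a0 * \<bar>h x - h y\<bar> \<le> \<bar>x - y\<bar>" for x y
  proof (cases "h x" "h y" rule: linorder_cases)
    case less
    then show ?thesis using expand[OF less h(1) h(1)] h(2) by simp
  next
    case greater
    then show ?thesis using expand[OF greater h(1) h(1)] h(2) by simp
  qed simp
  then have lip: "\<bar>h x - h y\<bar> \<le> 1 / a0 * \<bar>x - y\<bar>" for x y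
    using \<open>a0 > 0\<close> by (simp add: field_simps)
  have "(1 / a0)-lipschitz_on UNIV h"
    using lip \<open>a0 > 0\<close> by (intro lipschitz_onI) (auto simp: dist_real_def)
  then have "isCont h y" for y
    using lipschitz_on_continuous_on continuous_on_eq_continuous_at open_UNIV by blast
  moreover have "\<phi>' (h y) \<noteq> 0" for y using ge[OF h(1), of y] \<open>a0 > 0\<close> by simp
  ultimately have "(h has_real_derivative inverse (\<phi>' (h y))) (at y)" for y
    using der[OF h(1)] h(2) by (intro DERIV_inverse_function[where a="y-1" and b="y+1" and f=\<phi>]) auto
  with h hphi lip show thesis by (rule that)
qed

section \<open>The periodic orbit of the planar system\<close>

text \<open>The zero mean of \<open>e\<close> enters as \<open>E T = E 0\<close>. The sign
  conditions on \<open>h\<close> and on \<open>\<mu> - k * g u\<close> are weak because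
  \<open>Poincare_Miranda_2\<close> asks only for weak signs.\<close>

lemma planar_periodic_orbit:
  fixes h g e :: "real \<Rightarrow> real"
  assumes "T > 0" "a \<ge> 0" "H \<ge> 0" "k \<ge> 0"
    and h_bd: "\<And>y. \<bar>h y\<bar> \<le> a" and h_lip: "\<And>x y. \<bar>h x - h y\<bar> \<le> H * \<bar>x - y\<bar>"
    and h_pos: "\<And>y. y \<ge> 0 \<Longrightarrow> h y \<ge> 0" and h_neg: "\<And>y. y \<le> 0 \<Longrightarrow> h y \<le> 0"
    and g_bd: "\<And>u. \<bar>g u\<bar> \<le> G" and g_lip: "\<And>x y. \<bar>g x - g y\<bar> \<le> \<bar>x - y\<bar>"
    and e_cont: "continuous_on UNIV e" and e_per: "periodic_fun_simple e T"
    and E: "\<And>t. (E has_real_derivative e t) (at t)" "E T = E 0"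
    and r_pos: "\<And>u. u \<ge> r \<Longrightarrow> \<mu> \<le> k * g u" and r_neg: "\<And>u. u \<le> - r \<Longrightarrow> k * g u \<le> \<mu>"
  obtains u y where "\<And>t. (u has_real_derivative h (y t)) (at t)"
    "\<And>t. (y has_real_derivative \<mu> + e t - lam * h (y t) - k * g (u t)) (at t)"
    "\<And>t. u (t + T) = u t" "\<And>t. y (t + T) = y t"
proof -
  define f where "f t z = (h (snd z), \<mu> + e t - lam * h (snd z) - k * g (fst z))"
    for t and z :: "real \<times> real"
  obtain M where M: "M \<ge> 0" "\<And>t. \<bar>e t\<bar> \<le> M"
    using bounded_of_periodic[OF e_cont e_per \<open>T > 0\<close>] by blast
  have "G \<ge> 0" using g_bd[of 0] by linarith
  \<comment> \<open>\<open>C\<close> bounds the speed of \<open>y\<close> as \<open>a\<close> bounds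
    that of \<open>u\<close>, so over one period they move by at most \<open>C * T\<close> and
    \<open>a * T\<close>.\<close>
  define C where "C = \<bar>\<mu>\<bar> + M + \<bar>lam\<bar> * a + k * G"
  have "C \<ge> 0" using M \<open>G \<ge> 0\<close> \<open>a \<ge> 0\<close> \<open>k \<ge> 0\<close> by (simp add: C_def)
  have f2_bd: "\<bar>snd (f t z)\<bar> \<le> C" for t z
  proof -
    have "\<bar>lam * h (snd z)\<bar> \<le> \<bar>lam\<bar> * a" "\<bar>k * g (fst z)\<bar> \<le> k * G"
      using h_bd g_bd \<open>k \<ge> 0\<close> by (auto simp: abs_mult intro!: mult_left_mono)
    then show ?thesis using M(2)[of t] unfolding f_def C_def snd_conv by linarith
  qed
  have f_bd: "norm (f t z) \<le> a + C" for t z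
    using norm_Pair_le[of "fst (f t z)" "snd (f t z)"] f2_bd[of t z] h_bd[of "snd z"]
    by (simp add: f_def)
  \<comment> \<open>\<open>H\<close> serves the first component and
    \<open>\<bar>lam\<bar> * H + k\<close> the second; the summand \<open>1\<close> makes
    \<open>L\<close> positive even if these vanish.\<close>
  define L where "L = H + (\<bar>lam\<bar> * H + k) + 1"
  have "L > 0" using \<open>H \<ge> 0\<close> \<open>k \<ge> 0\<close> by (simp add: L_def add_nonneg_pos)
  have f_lip: "norm (f t z - f t w) \<le> L * norm (z - w)" for t z w
  proof -
    let ?N = "norm (z - w)"
    have 1: "\<bar>fst z - fst w\<bar> \<le> ?N" "\<bar>snd z - snd w\<bar> \<le> ?N"
      using norm_fst_le[of "fst z - fst w" "snd z - snd w"]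
        norm_snd_le[of "snd z - snd w" "fst z - fst w"]
      by (simp_all add: minus_prod_def)
    have h: "\<bar>h (snd z) - h (snd w)\<bar> \<le> H * ?N"
      using h_lip[of "snd z" "snd w"] mult_left_mono[OF 1(2) \<open>H \<ge> 0\<close>] by linarith
    have g: "\<bar>g (fst z) - g (fst w)\<bar> \<le> ?N"
      using g_lip[of "fst z" "fst w"] 1(1) by linarith
    have "\<bar>lam * (h (snd z) - h (snd w))\<bar> \<le> \<bar>lam\<bar> * (H * ?N)"
         "\<bar>k * (g (fst z) - g (fst w))\<bar> \<le> k * ?N"
      using h g \<open>k \<ge> 0\<close> by (auto simp: abs_mult intro!: mult_left_mono)
    then have "\<bar>snd (f t z - f t w)\<bar> \<le> (\<bar>lam\<bar> * H + k) * ?N"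
      by (simp add: f_def algebra_simps)
    moreover have "\<bar>fst (f t z - f t w)\<bar> \<le> H * ?N" using h by (simp add: f_def)
    moreover have "norm (f t z - f t w) \<le> \<bar>fst (f t z - f t w)\<bar> + \<bar>snd (f t z - f t w)\<bar>"
      using norm_Pair_le[of "fst (f t z - f t w)" "snd (f t z - f t w)"]
      unfolding prod.collapse real_norm_def .
    ultimately show ?thesis
      using norm_ge_zero[of "z - w"] unfolding L_def distrib_right mult_1 by linarith
  qed
  have ch: "continuous_on UNIV h"
    using h_lip \<open>H \<ge> 0\<close> by (intro lipschitz_on_continuous_on[of H] lipschitz_onI) (auto simp: dist_real_def)
  have cg: "continuous_on UNIV g"
    using g_lip by (intro lipschitz_on_continuous_on[of 1] lipschitz_onI) (auto simp: dist_real_def)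
  have f_cont: "continuous_on UNIV (\<lambda>(t, z). f t z)"
    unfolding f_def case_prod_beta
    by (intro continuous_intros continuous_on_compose2[OF ch] continuous_on_compose2[OF cg]
        continuous_on_compose2[OF e_cont]) auto
  have "\<exists>X. \<forall>z. X z 0 = z \<and> (\<forall>t. (X z has_vector_derivative f t (X z t)) (at t))"
    by (rule choice) (use bounded_Lipschitz_ode_solution[OF f_cont f_bd \<open>L > 0\<close> f_lip] in blast)
  then obtain X where X0: "\<And>z. X z 0 = z"
    and X: "\<And>z t. (X z has_vector_derivative f t (X z t)) (at t)" by blast
  have dist: "norm (x t - y t) \<le> 2 * norm (x 0 - y 0) * exp (2 * L * \<bar>t\<bar>)"
    if "\<And>t. (x has_vector_derivative f t (x t)) (at t)"
       "\<And>t. (y has_vector_derivative f t (y t)) (at t)" for x y t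
    using bounded_ode_solutions_dist[OF f_bd \<open>L > 0\<close> f_lip that] .
  define u y where "u z t = fst (X z t)" and "y z t = snd (X z t)" for z t
  have u: "(u z has_real_derivative h (y z t)) (at t)"
    and y: "(y z has_real_derivative \<mu> + e t - lam * h (y z t) - k * g (u z t)) (at t)" for z t
    using bounded_linear.has_vector_derivative[OF bounded_linear_fst X[of z t]]
      bounded_linear.has_vector_derivative[OF bounded_linear_snd X[of z t]]
    by (simp_all add: has_real_derivative_iff_has_vector_derivative u_def[abs_def] y_def[abs_def] f_def)
  have u_near: "\<bar>u z t - fst z\<bar> \<le> a * T" if "t \<in> {0..T}" for z t
  proof -
    have "norm (u z t - u z 0) \<le> a * norm (t - 0)"
      by (rule field_differentiable_bound[where S=UNIV, OF _ u]) (use h_bd in auto)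
    also have "\<dots> \<le> a * T" using that \<open>a \<ge> 0\<close> by (auto intro: mult_left_mono)
    finally show ?thesis by (simp add: u_def X0)
  qed
  have y_near: "\<bar>y z t - snd z\<bar> \<le> C * T" if "t \<in> {0..T}" for z t
  proof -
    have "norm (y z t - y z 0) \<le> C * norm (t - 0)"
    proof (rule field_differentiable_bound[where S=UNIV, OF _ y])
      show "norm (\<mu> + e s - lam * h (y z s) - k * g (u z s)) \<le> C" for s
        using f2_bd[of s "X z s"] by (simp add: f_def u_def y_def)
    qed auto
    also have "\<dots> \<le> C * T" using that \<open>C \<ge> 0\<close> by (auto intro: mult_left_mono)
    finally show ?thesis by (simp add: y_def X0)
  qed
  \<comment> \<open>The term \<open>lam * u\<close> cancels the damping and \<open>E\<close> the
    forcing, leaving a derivative whose sign depends on \<open>u\<close> alone.\<close>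
  define P where "P z t = y z t + lam * u z t - E t" for z t
  have P: "(P z has_real_derivative \<mu> - k * g (u z t)) (at t)" for z t
    unfolding P_def by (auto intro!: derivative_eq_intros u y E(1))
  \<comment> \<open>The period map \<open>X z T\<close> is Lipschitz in the initial value
    \<open>z\<close>, hence continuous.\<close>
  have "norm (X z T - X w T) \<le> 2 * norm (z - w) * exp (2 * L * \<bar>T\<bar>)" for z w
    using dist[OF X[of z] X[of w]] unfolding X0 by blast
  then have cX: "continuous_on UNIV (\<lambda>z. X z T)"
    by (intro lipschitz_on_continuous_on[of "2 * exp (2 * L * \<bar>T\<bar>)"] lipschitz_onI)
      (auto simp: dist_norm X0 algebra_simps)
  have incr: "F 0 \<le> F T"
    if "\<And>t. (F has_real_derivative F' t) (at t)" "\<And>t. t \<in> {0..T} \<Longrightarrow> F' t \<ge> 0"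
    for F F' :: "real \<Rightarrow> real"
  proof (rule DERIV_nonneg_imp_nondecreasing[of 0 T F])
    show "\<exists>D. (F has_real_derivative D) (at t) \<and> D \<ge> 0" if "0 \<le> t" "t \<le> T" for t
      using \<open>\<And>t. (F has_real_derivative F' t) (at t)\<close>[of t]
        \<open>\<And>t. t \<in> {0..T} \<Longrightarrow> F' t \<ge> 0\<close>[of t] that by auto
  qed (use \<open>T > 0\<close> in simp)
  have decr: "F T \<le> F 0"
    if "\<And>t. (F has_real_derivative F' t) (at t)" "\<And>t. t \<in> {0..T} \<Longrightarrow> F' t \<le> 0"
    for F F' :: "real \<Rightarrow> real"
    using incr[OF DERIV_minus[OF that(1)]] that(2) by simp
  have "continuous_on UNIV (\<lambda>z. P z 0 - P z T)" "continuous_on UNIV (\<lambda>z. u z T - u z 0)"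
    unfolding P_def u_def y_def X0 by (intro continuous_intros cX)+
  \<comment> \<open>Starting at \<open>\<bar>r\<bar> + a * T\<close>, \<open>u\<close> stays above
    \<open>r\<close> for the whole period, so \<open>P\<close> does not increase. The increment of
    \<open>P\<close> is taken with reversed sign to fit the orientation in
    \<open>Poincare_Miranda_2\<close>.\<close>
  moreover have "P (\<bar>r\<bar> + a * T, s) 0 - P (\<bar>r\<bar> + a * T, s) T \<ge> 0" for s
  proof -
    let ?z = "(\<bar>r\<bar> + a * T, s)"
    have "\<mu> \<le> k * g (u ?z t)" if "t \<in> {0..T}" for t
      using u_near[OF that, of ?z] by (intro r_pos) auto
    then have "P ?z T \<le> P ?z 0"
      by (intro decr[OF P]) simp
    then show ?thesis by simp
  qed
  moreover have "P (- (\<bar>r\<bar> + a * T), s) 0 - P (- (\<bar>r\<bar> + a * T), s) T \<le> 0" for s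
  proof -
    let ?z = "(- (\<bar>r\<bar> + a * T), s)"
    have "k * g (u ?z t) \<le> \<mu>" if "t \<in> {0..T}" for t
      using u_near[OF that, of ?z] by (intro r_neg) auto
    then have "P ?z 0 \<le> P ?z T"
      by (intro incr[OF P]) simp
    then show ?thesis by simp
  qed
  \<comment> \<open>Starting at height \<open>C * T\<close>, \<open>y\<close> stays nonnegative
    during the period, and so does \<open>h (y)\<close>.\<close>
  moreover have "u (s, C * T) T - u (s, C * T) 0 \<ge> 0" for s
  proof -
    have "0 \<le> h (y (s, C * T) t)" if "t \<in> {0..T}" for t
      using y_near[OF that, of "(s, C * T)"] by (intro h_pos) auto
    then have "u (s, C * T) 0 \<le> u (s, C * T) T"
      by (intro incr[OF u]) simp
    then show ?thesis by simp
  qed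
  moreover have "u (s, - (C * T)) T - u (s, - (C * T)) 0 \<le> 0" for s
  proof -
    have "h (y (s, - (C * T)) t) \<le> 0" if "t \<in> {0..T}" for t
      using y_near[OF that, of "(s, - (C * T))"] by (intro h_neg) auto
    then have "u (s, - (C * T)) T \<le> u (s, - (C * T)) 0"
      by (intro decr[OF u]) simp
    then show ?thesis by simp
  qed
  moreover have "\<bar>r\<bar> + a * T \<ge> 0" "C * T \<ge> 0" using \<open>T > 0\<close> \<open>a \<ge> 0\<close> \<open>C \<ge> 0\<close> by simp_all
  ultimately obtain z where z: "P z 0 - P z T = 0" "u z T - u z 0 = 0"
    using Poincare_Miranda_2[of "\<bar>r\<bar> + a * T" "C * T" "\<lambda>z. P z 0 - P z T" "\<lambda>z. u z T - u z 0"]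
    by blast
  \<comment> \<open>Once \<open>u\<close> and \<open>E\<close> agree at \<open>0\<close> and
    \<open>T\<close>, equality of the values of \<open>P\<close> is equality of those of
    \<open>y\<close>.\<close>
  have per0: "X z T = X z 0"
    using z E(2) by (simp add: P_def u_def y_def prod_eq_iff)
  interpret periodic_fun_simple e T by fact
  \<comment> \<open>By periodicity of \<open>e\<close>, the shifted curve solves the same system. It
    has the same initial value by \<open>per0\<close>, so the distance estimate identifies the two
    curves.\<close>
  have "((\<lambda>s. X z (s + T)) has_vector_derivative f t (X z (t + T))) (at t)" for t
  proof -
    have "((\<lambda>s. s + T) has_vector_derivative 1) (at t)"
      by (auto intro!: derivative_eq_intros)
    from vector_diff_chain_at[OF this X] show ?thesis by (simp add: o_def f_def plus_1)
  qed
  from dist[OF this X[of z]] have "X z (t + T) = X z t" for t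
    using per0 by simp
  then show thesis using that[OF u y, of z] by (simp add: u_def y_def)
qed

section \<open>The equivalence for the original equation\<close>

theorem theorem4p2:
  fixes T a \<omega> lam k a0 gminf ginf \<mu> :: real
    and \<phi> g e :: "real \<Rightarrow> real"
  assumes T_pos: "T > 0" and a_pos: "a > 0" and omega: "\<omega> = 2 * pi / T"
    and phi_incr: "strict_mono_on {-a<..<a} \<phi>"
    and phi_C2: "\<phi> C2_differentiable_on {-a<..<a}"
    and phi_0: "\<phi> 0 = 0"
    and phi_right: "filterlim \<phi> at_top (at_left a)"
    and phi_left: "filterlim \<phi> at_bot (at_right (-a))"
    and g_C1: "g C1_differentiable_on UNIV"
    and e_cont: "continuous_on UNIV e"
    and e_per: "periodic_fun_simple e T"
    and e_mean: "integral {0..T} e = 0"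
    and phi_deriv: "\<And>z. z \<in> {-a<..<a} \<Longrightarrow> deriv \<phi> z \<ge> a0"
    and g_deriv: "\<And>u. \<bar>deriv g u\<bar> \<le> 1"
    and k_pos: "0 < k" and k_less: "k < a0 * \<omega>"
    and g_bot: "(g \<longlongrightarrow> gminf) at_bot"
    and g_top: "(g \<longlongrightarrow> ginf) at_top"
    and g_between: "\<And>u. gminf < g u \<and> g u < ginf"
  shows "(\<exists>u. periodic_solution T a \<phi> lam k g \<mu> e u) \<longleftrightarrow>
    k * gminf < \<mu> \<and> \<mu> < k * ginf"
proof -
  have a0: "a0 > 0"
    using k_pos k_less T_pos omega by (metis divide_pos_pos less_trans mult_pos_pos pi_gt_zero
        zero_less_mult_pos2 zero_less_numeral)
  have phi_der: "(\<phi> has_real_derivative deriv \<phi> z) (at z)" if "z \<in> {-a<..<a}" for z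
    using phi_C2 that by (simp add: C2_differentiable_on_def DERIV_deriv_iff_real_differentiable)
  obtain E where E: "\<And>t. (E has_real_derivative e t) (at t)"
    using antiderivative_on_line[OF e_cont]
    by (metis has_real_derivative_iff_has_vector_derivative)
  have "(e has_integral E T - E 0) {0..T}"
    using T_pos E by (intro fundamental_theorem_of_calculus)
      (auto simp: has_real_derivative_iff_has_vector_derivative[symmetric] intro: DERIV_subset)
  from integral_unique[OF this] have E_per: "E T = E 0" using e_mean by simp
  show ?thesis
  proof
    assume "\<exists>u. periodic_solution T a \<phi> lam k g \<mu> e u"
    then obtain u where u: "periodic_fun_simple u T" "u C2_differentiable_on UNIV"
        "\<And>t. \<bar>deriv u t\<bar> < a"
      and eq: "\<And>t. deriv (\<lambda>s. \<phi> (deriv u s)) t + lam * deriv u t + k * g (u t) = \<mu> + e t"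
      by (auto simp: periodic_solution_def)
    interpret periodic_fun_simple u T by fact
    have u': "(u has_real_derivative deriv u t) (at t)" for t
      using u(2) by (simp add: C2_differentiable_on_def DERIV_deriv_iff_real_differentiable)
    have "deriv u differentiable (at t)" for t
      using u(2) by (simp add: C2_differentiable_on_def C1_differentiable_on_eq)
    then have u'': "(deriv u has_real_derivative deriv (deriv u) t) (at t)" for t
      by (simp add: DERIV_deriv_iff_real_differentiable)
    have "(\<phi> has_real_derivative deriv \<phi> (deriv u t)) (at (deriv u t))" for t
      using u(3)[of t] by (intro phi_der) (simp add: abs_less_iff)
    from DERIV_chain2[OF this u''] have "(\<lambda>s. \<phi> (deriv u s)) differentiable (at t)" for t
      using real_differentiable_def by blast
    then have der: "((\<lambda>s. \<phi> (deriv u s)) has_real_derivative deriv (\<lambda>s. \<phi> (deriv u s)) t) (at t)" for t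
      by (simp add: DERIV_deriv_iff_real_differentiable)
    define P where "P t = \<phi> (deriv u t) + lam * u t - E t" for t
    have P: "(P has_real_derivative \<mu> - k * g (u t)) (at t)" for t
      unfolding P_def using eq[of t]
        by (auto intro!: derivative_eq_intros der u' E simp: algebra_simps)
    \<comment> \<open>\<open>P\<close> contains \<open>\<phi> (u')\<close>, so the periodicity of
      \<open>u\<close> has to be passed on to its derivative.\<close>
    have "deriv u (0 + T) = deriv u 0"
      using DERIV_shift[of u "deriv u (0 + T)" 0 T] u'[of "0 + T"]
      by (intro DERIV_imp_deriv[symmetric]) (simp add: plus_1)
    then have "P T = P 0" using E_per plus_1[of 0] by (simp add: P_def)
    moreover obtain t where "P T - P 0 = (T - 0) * (\<mu> - k * g (u t))"
      using MVT2[OF T_pos P] by blast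
    ultimately have "\<mu> = k * g (u t)" using T_pos by simp
    then show "k * gminf < \<mu> \<and> \<mu> < k * ginf" using g_between k_pos by simp
  next
    assume \<mu>: "k * gminf < \<mu> \<and> \<mu> < k * ginf"
    obtain h where h: "\<And>y. h y \<in> {-a<..<a}" "\<And>y. \<phi> (h y) = y"
      "\<And>z. z \<in> {-a<..<a} \<Longrightarrow> h (\<phi> z) = z"
      "\<And>x y. \<bar>h x - h y\<bar> \<le> 1 / a0 * \<bar>x - y\<bar>"
      "\<And>y. (h has_real_derivative inverse (deriv \<phi> (h y))) (at y)"
      using singular_homeomorphism_inverse[OF a_pos a0 phi_incr phi_der phi_deriv phi_right phi_left]
      by blast
    have h_less: "h x < h y" if "x < y" for x y
      using that strict_mono_on_leD[OF phi_incr h(1) h(1), of y x] h(2) by force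
    have "h 0 = 0" using h(3)[of 0] phi_0 a_pos by simp
    then have h_pos: "h y \<ge> 0" if "y \<ge> 0" for y using h_less[of 0 y] that by (cases "y = 0") auto
    have h_neg: "h y \<le> 0" if "y \<le> 0" for y
      using h_less[of y 0] that \<open>h 0 = 0\<close> by (cases "y = 0") auto
    have g_der: "(g has_real_derivative deriv g u) (at u)" for u
      using g_C1 by (simp add: C1_differentiable_on_eq DERIV_deriv_iff_real_differentiable)
    have g_lip: "\<bar>g x - g y\<bar> \<le> \<bar>x - y\<bar>" for x y
      using field_differentiable_bound[of UNIV g "deriv g" 1 x y] g_der g_deriv by simp
    have g_bd: "\<bar>g u\<bar> \<le> \<bar>gminf\<bar> + \<bar>ginf\<bar>" for u using g_between[of u] by linarith
    \<comment> \<open>\<open>\<mu> / k\<close> lies strictly between the limits of \<open>g\<close>,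
      so \<open>g\<close> is on the correct side of it for large \<open>\<bar>u\<bar>\<close>;
      \<open>\<bar>r1\<bar> + \<bar>r2\<bar>\<close> is a threshold valid at both ends.\<close>
    have "\<forall>\<^sub>F u in at_top. \<mu> / k < g u" "\<forall>\<^sub>F u in at_bot. g u < \<mu> / k"
      using order_tendstoD(1)[OF g_top, of "\<mu> / k"] order_tendstoD(2)[OF g_bot, of "\<mu> / k"] \<mu> k_pos
      by (simp_all add: pos_divide_less_eq pos_less_divide_eq mult.commute)
    then obtain r1 r2 where "\<And>u. u \<ge> r1 \<Longrightarrow> \<mu> / k < g u" "\<And>u. u \<le> r2 \<Longrightarrow> g u < \<mu> / k"
      by (auto simp: eventually_at_top_linorder eventually_at_bot_linorder)
    then have r: "u \<ge> \<bar>r1\<bar> + \<bar>r2\<bar> \<Longrightarrow> \<mu> \<le> k * g u" "u \<le> - (\<bar>r1\<bar> + \<bar>r2\<bar>) \<Longrightarrow> k * g u \<le> \<mu>" for u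
      using k_pos by (simp_all add: field_simps less_imp_le)
    have h_bd: "\<bar>h y\<bar> \<le> a" for y using h(1)[of y] by auto
    obtain u y where u: "\<And>t. (u has_real_derivative h (y t)) (at t)"
      and y: "\<And>t. (y has_real_derivative \<mu> + e t - lam * h (y t) - k * g (u t)) (at t)"
      and per: "\<And>t. u (t + T) = u t"
      using planar_periodic_orbit[OF T_pos less_imp_le[OF a_pos] _ less_imp_le[OF k_pos] h_bd h(4) h_pos h_neg
          g_bd g_lip e_cont e_per E E_per r] a0 by (metis less_imp_le zero_less_divide_1_iff)
    have deriv_u: "deriv u = (\<lambda>t. h (y t))"
      using u by (auto intro: DERIV_imp_deriv)
    have "periodic_fun_simple u T" by standard (rule per)
    moreover have "u C2_differentiable_on UNIV"
    proof -
      \<comment> \<open>\<open>D\<close> is the second derivative of \<open>u\<close>, by the chain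
        rule for \<open>u' = h (y)\<close>. It is continuous because \<open>deriv \<phi>\<close> is
        continuous and at least \<open>a0 > 0\<close>.\<close>
      define D where "D t = inverse (deriv \<phi> (h (y t))) * (\<mu> + e t - lam * h (y t) - k * g (u t))" for t
      have D: "((\<lambda>t. h (y t)) has_real_derivative D t) (at t)" for t
        unfolding D_def by (rule DERIV_chain2[OF h(5) y])
      have cont: "continuous_on UNIV f" if "\<And>t. (f has_real_derivative f' t) (at t)" for f f'
        using that DERIV_isCont continuous_at_imp_continuous_on by blast
      have "continuous_on {-a<..<a} (deriv \<phi>)"
        using phi_C2 by (simp add: C2_differentiable_on_def C1_differentiable_on_eq
            continuous_at_imp_continuous_on differentiable_imp_continuous_within)
      from continuous_on_compose2[OF this cont[OF D]] h(1)
      have "continuous_on UNIV (\<lambda>t. deriv \<phi> (h (y t)))" by blast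
      moreover from continuous_on_compose2[OF cont[OF g_der] cont[OF u]]
      have "continuous_on UNIV (\<lambda>t. g (u t))" by simp
      moreover have "deriv \<phi> (h (y t)) \<noteq> 0" for t using phi_deriv[OF h(1), of "y t"] a0 by simp
      ultimately have "continuous_on UNIV D"
        unfolding D_def by (intro continuous_intros cont[OF D] e_cont) simp_all
      then have "deriv u C1_differentiable_on UNIV"
        using D unfolding C1_differentiable_on_def deriv_u
        by (auto simp flip: has_real_derivative_iff_has_vector_derivative)
      then show ?thesis
        using u real_differentiable_def unfolding C2_differentiable_on_def by blast
    qed
    moreover have "\<bar>deriv u t\<bar> < a" for t using h(1)[of "y t"] by (auto simp: deriv_u)
    \<comment> \<open>Since \<open>u' = h (y)\<close> inverts to \<open>\<phi> (u') = y\<close>,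
      this is the equation for \<open>y\<close>.\<close>
    moreover have "deriv (\<lambda>s. \<phi> (deriv u s)) t + lam * deriv u t + k * g (u t) = \<mu> + e t" for t
      using DERIV_imp_deriv[OF y, of t] by (simp add: deriv_u h(2))
    ultimately show "\<exists>u. periodic_solution T a \<phi> lam k g \<mu> e u"
      unfolding periodic_solution_def by blast
  qed
qed

end
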